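(* In every plane satisfying the axioms of $\mathcal{M}^{-}$ (the Hilbert plane axioms without SAS), if the ASA criterion and the ray correspondence principle [RCT] hold, then the SAS criterion holds.
   Context: The axiom system $\mathcal{M}^{-}$ (a Hilbert plane with the SAS axiom removed) has points, lines, incidence, betweenness $A-B-C$, congruence $\equiv$ of segments and congruence $\equiv$ of angles as primitive notions, with axioms: [I1] Two distinct points are incident with a unique line. [I2] Every line is incident with at least two distinct points. [I3] There are three distinct points not all incident with one line. [O1] If $A-B-C$ then $A,B,C$ are distinct and collinear, and $C-B-A$. [O2] For distinct $B,D$ there are points $A,C,E$ on line $BD$ with $A-B-D$, $B-C-D$, $B-D-E$. [O3] Of three distinct collinear points exactly one is between the other two. [O4] For a line $l$ and points $A,B,C$ not on $l$: (i) if $A,B$ are on the same side of $l$ and $B,C$ are on the same side, then $A,C$ are on the same side; (ii) if $A,B$ are on opposite sides and $B,C$ are on opposite sides, then $A,C$ are on the same side. (Distinct points $X,Y$ not on $l$ are on opposite sides of $l$ if segment $XY$ meets $l$, otherwise on the same side; a point is on the same side as itself.) [C1] If $A\neq B$ and $r$ is a ray from $A'$, there is a unique $B'\ne A'$ on $r$ with $AB\equiv A'B'$. [C2] If $AB\equiv CD$ and $AB\equiv EF$ then $CD\equiv EF$; every segment is congruent to itself. [C3] If $A-B-C$, $A'-B'-C'$, $AB\equiv A'B'$, $BC\equiv B'C'$, then $AC\equiv A'C'$. [C4] Given an angle $\angle BAC$ and a ray $\overrightarrow{A'B'}$, there is a unique ray $\overrightarrow{A'C'}$ on a given side of line $A'B'$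 with $\angle B'A'C'\equiv\angle BAC$. [C5] If $\angle A\equiv\angle B$ and $\angle A\equiv\angle C$ then $\angle B\equiv\angle C$; every angle is congruent to itself. Segments and angles are unordered ($AB=BA$, $\angle ABC=\angle CBA$); an angle consists of two rays with common origin that are neither equal nor opposite. The interior of $\angle ABC$ is the set of points on the same side of line $BA$ as $C$ and on the same side of line $BC$ as $A$. A ray $\overrightarrow{BG}$ is between $\overrightarrow{BA}$ and $\overrightarrow{BC}$ if $G$ is in the interior of $\angle ABC$. Triangles have noncollinear vertices; $\triangle ABC\equiv\triangle DEF$ means that, under $A\mapsto D$, $B\mapsto E$, $C\mapsto F$, all corresponding sides and all corresponding angles are congruent. Principles (universally quantified): SAS: $AB\equiv DE$, $\angle BAC\equiv\angle EDF$, $AC\equiv DF$ imply $\triangle ABC\equiv\triangle DEF$. ASA: $\angle BAC\equiv\angle EDF$, $AB\equiv DE$, $\angle ABC\equiv\angle DEF$ imply $\triangle ABC\equiv\triangle DEF$. [RCT]: Given $\angle ABC\equiv\angle DEF$, for every ray $\overrightarrow{BG}$ between $\overrightarrow{BA}$ and $\overrightarrow{BC}$ there exists a unique ray $\overrightarrow{EH}$ between $\overrightarrow{ED}$ and $\overrightarrow{EF}$ such that $\angle GBC\equiv\angle HEF$ and $\angle ABG\equiv\angle DEH$. *)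

theory Defs
  imports Main
begin

text \<open>
  Segments, rays and angles are sets, so that congruence is a relation between geometric objects,
  not between the points that name them. In particular angles are unordered and do not depend on
  the points chosen on their sides.
\<close>

locale plane_signature =
  fixes inc :: "'p \<Rightarrow> 'l \<Rightarrow> bool"
    and betw :: "'p \<Rightarrow> 'p \<Rightarrow> 'p \<Rightarrow> bool"
    and seg_cong :: "'p set \<Rightarrow> 'p set \<Rightarrow> bool"
    and ang_cong :: "'p set set \<Rightarrow> 'p set set \<Rightarrow> bool"
begin

definition collinear :: "'p \<Rightarrow> 'p \<Rightarrow> 'p \<Rightarrow> bool" where
  "collinear A B C \<longleftrightarrow> (\<exists>l. inc A l \<and> inc B l \<and> inc C l)"

text \<open>Only meaningful for two distinct points.\<close>
definition line_through :: "'p \<Rightarrow> 'p \<Rightarrow> 'l" where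
  "line_through A B = (THE l. inc A l \<and> inc B l)"

definition segment :: "'p \<Rightarrow> 'p \<Rightarrow> 'p set" where
  "segment A B = {A, B} \<union> {X. betw A X B}"

definition is_segment :: "'p set \<Rightarrow> bool" where
  "is_segment s \<longleftrightarrow> (\<exists>A B. A \<noteq> B \<and> s = segment A B)"

definition same_side :: "'l \<Rightarrow> 'p \<Rightarrow> 'p \<Rightarrow> bool" where
  "same_side l X Y \<longleftrightarrow> \<not> inc X l \<and> \<not> inc Y l \<and>
     (X = Y \<or> \<not> (\<exists>P \<in> segment X Y. inc P l))"

definition opposite_sides :: "'l \<Rightarrow> 'p \<Rightarrow> 'p \<Rightarrow> bool" where
  "opposite_sides l X Y \<longleftrightarrow> \<not> inc X l \<and> \<not> inc Y l \<and>
     X \<noteq> Y \<and> (\<exists>P \<in> segment X Y. inc P l)"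

text \<open>The ray from \<open>A\<close> through \<open>B\<close>, including its origin \<open>A\<close>; a genuine ray only if \<open>A \<noteq> B\<close>.\<close>
definition ray :: "'p \<Rightarrow> 'p \<Rightarrow> 'p set" where
  "ray A B = {A, B} \<union> {X. betw A X B} \<union> {X. betw A B X}"

definition opposite_rays :: "'p set \<Rightarrow> 'p set \<Rightarrow> bool" where
  "opposite_rays r s \<longleftrightarrow> (\<exists>A B C. betw A B C \<and> r = ray B A \<and> s = ray B C)"

text \<open>The middle argument is the vertex.\<close>
definition angle :: "'p \<Rightarrow> 'p \<Rightarrow> 'p \<Rightarrow> 'p set set" where
  "angle A B C = {ray B A, ray B C}"

definition forms_angle :: "'p \<Rightarrow> 'p \<Rightarrow> 'p \<Rightarrow> bool" where
  "forms_angle A B C \<longleftrightarrow> A \<noteq> B \<and> C \<noteq> B \<and>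
     ray B A \<noteq> ray B C \<and> \<not> opposite_rays (ray B A) (ray B C)"

definition is_angle :: "'p set set \<Rightarrow> bool" where
  "is_angle \<alpha> \<longleftrightarrow> (\<exists>A B C. forms_angle A B C \<and> \<alpha> = angle A B C)"

definition angle_interior :: "'p \<Rightarrow> 'p \<Rightarrow> 'p \<Rightarrow> 'p set" where
  "angle_interior A B C =
     {P. same_side (line_through B A) P C \<and> same_side (line_through B C) P A}"

definition triangle :: "'p \<Rightarrow> 'p \<Rightarrow> 'p \<Rightarrow> bool" where
  "triangle A B C \<longleftrightarrow> \<not> collinear A B C"

definition triangle_cong :: "'p \<Rightarrow> 'p \<Rightarrow> 'p \<Rightarrow> 'p \<Rightarrow> 'p \<Rightarrow> 'p \<Rightarrow> bool" where
  "triangle_cong A B C D E F \<longleftrightarrow> triangle A B C \<and> triangle D E F \<and>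
     seg_cong (segment A B) (segment D E) \<and>
     seg_cong (segment B C) (segment E F) \<and>
     seg_cong (segment A C) (segment D F) \<and>
     ang_cong (angle B A C) (angle E D F) \<and>
     ang_cong (angle A B C) (angle D E F) \<and>
     ang_cong (angle A C B) (angle D F E)"

definition SAS :: bool where
  "SAS \<longleftrightarrow> (\<forall>A B C D E F. triangle A B C \<longrightarrow> triangle D E F \<longrightarrow>
     seg_cong (segment A B) (segment D E) \<longrightarrow>
     ang_cong (angle B A C) (angle E D F) \<longrightarrow>
     seg_cong (segment A C) (segment D F) \<longrightarrow>
     triangle_cong A B C D E F)"

definition ASA :: bool where
  "ASA \<longleftrightarrow> (\<forall>A B C D E F. triangle A B C \<longrightarrow> triangle D E F \<longrightarrow>
     ang_cong (angle B A C) (angle E D F) \<longrightarrow>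
     seg_cong (segment A B) (segment D E) \<longrightarrow>
     ang_cong (angle A B C) (angle D E F) \<longrightarrow>
     triangle_cong A B C D E F)"

text \<open>The ray correspondence principle. Uniqueness concerns the ray \<open>h\<close>, not the point \<open>H\<close> on it.\<close>
definition RCT :: bool where
  "RCT \<longleftrightarrow> (\<forall>A B C D E F. forms_angle A B C \<longrightarrow> forms_angle D E F \<longrightarrow>
     ang_cong (angle A B C) (angle D E F) \<longrightarrow>
     (\<forall>G \<in> angle_interior A B C.
        \<exists>!h. \<exists>H \<in> angle_interior D E F. h = ray E H \<and>
          ang_cong (angle G B C) (angle H E F) \<and>
          ang_cong (angle A B G) (angle D E H)))"

end

text \<open>
  A Hilbert plane without the SAS axiom. The congruence relations are constrained only on genuine
  segments and angles.
\<close>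

locale hilbert_plane_without_SAS = plane_signature inc betw seg_cong ang_cong
  for inc :: "'p \<Rightarrow> 'l \<Rightarrow> bool"
    and betw :: "'p \<Rightarrow> 'p \<Rightarrow> 'p \<Rightarrow> bool"
    and seg_cong :: "'p set \<Rightarrow> 'p set \<Rightarrow> bool"
    and ang_cong :: "'p set set \<Rightarrow> 'p set set \<Rightarrow> bool" +
  assumes I1: "A \<noteq> B \<Longrightarrow> \<exists>!l. inc A l \<and> inc B l"
    and I2: "\<exists>A B. A \<noteq> B \<and> inc A l \<and> inc B l"
    and I3: "\<exists>A B C. A \<noteq> B \<and> A \<noteq> C \<and> B \<noteq> C \<and> \<not> collinear A B C"
    and O1: "betw A B C \<Longrightarrow>
      A \<noteq> B \<and> A \<noteq> C \<and> B \<noteq> C \<and> collinear A B C \<and> betw C B A"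
    and O2: "B \<noteq> D \<Longrightarrow>
      \<exists>A C E. inc A (line_through B D) \<and> inc C (line_through B D) \<and> inc E (line_through B D) \<and>
        betw A B D \<and> betw B C D \<and> betw B D E"
    and O3: "\<lbrakk>A \<noteq> B; A \<noteq> C; B \<noteq> C; collinear A B C\<rbrakk> \<Longrightarrow>
      (betw B A C \<and> \<not> betw A B C \<and> \<not> betw A C B) \<or>
      (\<not> betw B A C \<and> betw A B C \<and> \<not> betw A C B) \<or>
      (\<not> betw B A C \<and> \<not> betw A B C \<and> betw A C B)"
    and O4_same: "\<lbrakk>same_side l A B; same_side l B C\<rbrakk> \<Longrightarrow> same_side l A C"
    and O4_opposite: "\<lbrakk>opposite_sides l A B; opposite_sides l B C\<rbrakk> \<Longrightarrow> same_side l A C"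
    and C1: "\<lbrakk>A \<noteq> B; A' \<noteq> P\<rbrakk> \<Longrightarrow>
      \<exists>!B'. B' \<noteq> A' \<and> B' \<in> ray A' P \<and> seg_cong (segment A B) (segment A' B')"
    and C2_euclidean: "\<lbrakk>is_segment s; is_segment t; is_segment u; seg_cong s t; seg_cong s u\<rbrakk> \<Longrightarrow>
      seg_cong t u"
    and C2_refl: "is_segment s \<Longrightarrow> seg_cong s s"
    and C3: "\<lbrakk>betw A B C; betw A' B' C';
      seg_cong (segment A B) (segment A' B'); seg_cong (segment B C) (segment B' C')\<rbrakk> \<Longrightarrow>
      seg_cong (segment A C) (segment A' C')"
    \<comment> \<open>\<open>P\<close> selects the given side of the line \<open>A'B'\<close>\<close>
    and C4: "\<lbrakk>forms_angle B A C; A' \<noteq> B'; \<not> inc P (line_through A' B')\<rbrakk> \<Longrightarrow>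
      \<exists>!r. \<exists>C'. r = ray A' C' \<and> same_side (line_through A' B') C' P \<and>
        ang_cong (angle B' A' C') (angle B A C)"
    and C5_euclidean: "\<lbrakk>is_angle \<alpha>; is_angle \<beta>; is_angle \<gamma>; ang_cong \<alpha> \<beta>; ang_cong \<alpha> \<gamma>\<rbrakk> \<Longrightarrow>
      ang_cong \<beta> \<gamma>"
    and C5_refl: "is_angle \<alpha> \<Longrightarrow> ang_cong \<alpha> \<alpha>"

end

theory Submission
  imports Defs
begin

text \<open>
  Given the SAS data for \<open>ABC\<close> and \<open>DEF\<close>, copy the angle at \<open>B\<close> to a ray from \<open>E\<close> on the side of
  \<open>F\<close>. If this ray is \<open>EF\<close>, ASA applies directly. If it lies inside the angle \<open>DEF\<close>, it meets the
  side \<open>DF\<close> by the crossbar theorem, and ASA yields a second point of the ray \<open>DF\<close> at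
  distance \<open>AC\<close> from \<open>D\<close>, against the uniqueness in [C1]. Otherwise \<open>EF\<close> lies inside the copied
  angle; [RCT] carries it back to a ray inside \<open>ABC\<close>, and the same argument applies to the side
  \<open>AC\<close>.
\<close>

context hilbert_plane_without_SAS
begin

section \<open>Incidence and order on a line\<close>

lemma line_unique: "\<lbrakk>A \<noteq> B; inc A l; inc B l; inc A m; inc B m\<rbrakk> \<Longrightarrow> l = m"
  using I1 by blast

lemma line_through_eq: "\<lbrakk>A \<noteq> B; inc A l; inc B l\<rbrakk> \<Longrightarrow> line_through A B = l"
  unfolding line_through_def by (rule the_equality) (auto intro: line_unique)

lemma inc_line_through:
  assumes "A \<noteq> B"
  shows "inc A (line_through A B)" "inc B (line_through A B)"
  using I1[OF assms] line_through_eq[OF assms] by auto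

lemma betw_commute: "betw A B C \<longleftrightarrow> betw C B A"
  using O1 by blast

lemma betw_distinct:
  assumes "betw A B C"
  shows "A \<noteq> B" "B \<noteq> A" "B \<noteq> C" "C \<noteq> B" "A \<noteq> C" "C \<noteq> A"
  using O1[OF assms] by auto

lemma betw_inc_left: "\<lbrakk>betw A B C; inc B l; inc C l\<rbrakk> \<Longrightarrow> inc A l"
  using O1[of A B C] line_unique unfolding collinear_def by blast

lemma betw_inc_right: "\<lbrakk>betw A B C; inc A l; inc B l\<rbrakk> \<Longrightarrow> inc C l"
  using O1[of A B C] line_unique unfolding collinear_def by blast

lemma betw_inc_mid: "\<lbrakk>betw A B C; inc A l; inc C l\<rbrakk> \<Longrightarrow> inc B l"
  using O1[of A B C] line_unique unfolding collinear_def by blast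

lemma betw_exclusive:
  assumes "betw A B C"
  shows "\<not> betw B A C" "\<not> betw A C B"
  using O3[of A B C] O1[OF assms] assms by blast+

lemma segment_commute: "segment A B = segment B A"
  unfolding segment_def using betw_commute by auto

section \<open>Sides of a line\<close>

lemma same_side_sym: "same_side l X Y \<Longrightarrow> same_side l Y X"
  unfolding same_side_def using segment_commute by auto

lemma same_sideD: "same_side l X Y \<Longrightarrow> \<not> inc X l" "same_side l X Y \<Longrightarrow> \<not> inc Y l"
  unfolding same_side_def by auto

lemma betw_not_same_side: "\<lbrakk>betw A B C; inc B l\<rbrakk> \<Longrightarrow> \<not> same_side l A C"
  using betw_distinct[of A B C] unfolding same_side_def segment_def by auto

lemma not_same_side_betw:
  assumes "\<not> same_side l A C" "\<not> inc A l" "\<not> inc C l"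
  obtains P where "betw A P C" "inc P l"
  using assms unfolding same_side_def segment_def by auto

text \<open>The line through \<open>A\<close> and \<open>C\<close> meets \<open>l\<close> only at
  \<open>A\<close>, and \<open>A\<close> is not between \<open>P\<close> and
  \<open>C\<close>.\<close>

lemma betw_same_side:
  assumes "betw A P C" "inc A l" "\<not> inc C l"
  shows "same_side l P C"
proof -
  have P: "\<not> inc P l" using assms betw_inc_right by blast
  have "\<not> inc X l" if X: "betw P X C" for X
  proof
    assume "inc X l"
    obtain m where m: "inc A m" "inc P m" "inc C m"
      using O1[OF assms(1)] unfolding collinear_def by blast
    then have "X = A"
      using line_unique[of X A l m] \<open>inc X l\<close> assms(2,3) betw_inc_mid[OF X] by blast
    then show False using X assms(1) betw_exclusive by blast
  qed
  then show ?thesis using P assms(3) unfolding same_side_def segment_def by auto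
qed

section \<open>Rays as half-lines\<close>

lemma ray_subset_line: "\<lbrakk>X \<in> ray A B; inc A l; inc B l\<rbrakk> \<Longrightarrow> inc X l"
  unfolding ray_def using betw_inc_mid betw_inc_right by auto

text \<open>The one collinear position outside the ray has \<open>A\<close> between \<open>B\<close>
  and \<open>X\<close>, which would put \<open>B\<close> and \<open>X\<close> on opposite sides of
  \<open>l\<close>.\<close>

lemma same_side_imp_ray:
  assumes "inc A l" "same_side l X B" "collinear A B X"
  shows "X \<in> ray A B"
proof (cases "X = B")
  case True
  then show ?thesis unfolding ray_def by simp
next
  case False
  have "A \<noteq> X" "A \<noteq> B" using assms(1,2) same_sideD by blast+
  moreover have "\<not> betw B A X"
    using betw_not_same_side[of B A X l] assms(1,2) same_side_sym by blast
  ultimately show ?thesis using O3[of A B X] False assms(3) unfolding ray_def by auto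
qed

lemma ray_imp_same_side:
  assumes "inc A l" "\<not> inc B l" "X \<in> ray A B" "X \<noteq> A"
  shows "same_side l X B"
proof -
  consider "X = B" | "betw A X B" | "betw A B X" using assms(3,4) unfolding ray_def by auto
  then show ?thesis
  proof cases
    case 1
    then show ?thesis using assms(2) by (simp add: same_side_def)
  next
    case 2
    then show ?thesis using betw_same_side assms by blast
  next
    case 3
    then have "\<not> inc X l" using assms betw_inc_mid by blast
    then show ?thesis using betw_same_side[OF 3] assms(1) same_side_sym by blast
  qed
qed

lemma exists_off_line:
  obtains P where "\<not> inc P l"
  using I3 unfolding collinear_def by blast

text \<open>An auxiliary line \<open>l\<close> meeting the line \<open>AB\<close> only at
  \<open>A\<close> turns membership in a ray into lying on one side of \<open>l\<close>. The
  equality then follows from transitivity of sides.\<close>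

lemma ray_eq:
  assumes "A \<noteq> B" "X \<in> ray A B" "X \<noteq> A"
  shows "ray A X = ray A B"
proof -
  define m where "m = line_through A B"
  have m: "inc A m" "inc B m" using inc_line_through[OF assms(1)] m_def by auto
  then have Xm: "inc X m" using ray_subset_line assms(2) by blast
  obtain P where P: "\<not> inc P m" by (rule exists_off_line)
  then have "A \<noteq> P" using m by auto
  define l where "l = line_through A P"
  have l: "inc A l" "inc P l" using inc_line_through[OF \<open>A \<noteq> P\<close>] l_def by auto
  have off: "\<not> inc Y l" if "inc Y m" "Y \<noteq> A" for Y
    using line_unique[of A Y l m] that l m P by auto
  have XB: "same_side l X B" using ray_imp_same_side off l m assms by blast
  \<comment> \<open>Kept general in \<open>U\<close> and \<open>V\<close>, so that \<open>XB\<close>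
    and its reverse give both inclusions.\<close>
  have sub: "Y \<in> ray A V" if "Y \<in> ray A U" and UV: "same_side l U V" "inc U m" "inc V m" for Y U V
  proof (cases "Y = A")
    case True
    then show ?thesis unfolding ray_def by simp
  next
    case False
    have "same_side l Y V"
      using ray_imp_same_side[OF l(1) same_sideD(1)[OF UV(1)] that(1) False] UV(1)
      by (rule O4_same)
    moreover have "inc Y m" using ray_subset_line that m by blast
    ultimately show ?thesis
      using same_side_imp_ray l(1) m(1) UV unfolding collinear_def by blast
  qed
  show ?thesis using sub XB same_side_sym[OF XB] Xm m by blast
qed

section \<open>Noncollinear points and genuine angles\<close>

lemma collinear_rotate: "collinear A B C \<Longrightarrow> collinear B C A"
  and collinear_swap: "collinear A B C \<Longrightarrow> collinear B A C"
  unfolding collinear_def by auto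

lemma not_collinear_distinct:
  assumes "\<not> collinear A B C"
  shows "A \<noteq> B" "A \<noteq> C" "B \<noteq> C"
proof -
  \<comment> \<open>Equal points are included: [I3] then supplies a second point to join with
    \<open>X\<close>.\<close>
  have two: "\<exists>l. inc X l \<and> inc Y l" for X Y
    using I1[of X Y] I1[of X] I3 by metis
  show "A \<noteq> B" "A \<noteq> C" "B \<noteq> C" using assms two unfolding collinear_def by metis+
qed

lemma not_inc_line_through: "\<not> collinear A B C \<Longrightarrow> \<not> inc C (line_through A B)"
  using not_collinear_distinct inc_line_through unfolding collinear_def by metis

lemma not_collinearI: "\<lbrakk>A \<noteq> B; inc A l; inc B l; \<not> inc C l\<rbrakk> \<Longrightarrow> \<not> collinear A B C"
  unfolding collinear_def using line_unique by blast

lemma not_collinear_betw: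
  assumes "\<not> collinear A B C" "betw A P C"
  shows "\<not> collinear A B P"
  using not_collinearI[of A B "line_through A B" P] betw_inc_right[OF assms(2)]
    not_inc_line_through[OF assms(1)] not_collinear_distinct[OF assms(1)] inc_line_through
  by metis

text \<open>If the two rays were equal or opposite, a single line would contain both and hence all
  three points.\<close>

lemma forms_angle_if_not_collinear:
  assumes "\<not> collinear A B C"
  shows "forms_angle A B C"
proof -
  note d = not_collinear_distinct[OF assms]
  have endpoint: "Y \<in> ray X Y" for X Y unfolding ray_def by simp
  have origin: "X \<in> ray X Y" for X Y unfolding ray_def by simp
  have "ray B A \<noteq> ray B C"
  proof
    assume "ray B A = ray B C"
    then have "C \<in> ray B A" using endpoint by metis
    then have "inc C (line_through A B)"
      using ray_subset_line inc_line_through[OF d(1)] by blast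
    then show False using not_inc_line_through assms by blast
  qed
  moreover have "\<not> opposite_rays (ray B A) (ray B C)"
  proof
    assume "opposite_rays (ray B A) (ray B C)"
    then obtain X Y Z where XYZ: "betw X Y Z" "ray B A = ray Y X" "ray B C = ray Y Z"
      unfolding opposite_rays_def by blast
    obtain l where l: "inc X l" "inc Y l" "inc Z l"
      using O1[OF XYZ(1)] unfolding collinear_def by blast
    have "inc A l" "inc B l" "inc C l"
      using ray_subset_line XYZ(2,3) l endpoint origin by metis+
    then show False using assms unfolding collinear_def by blast
  qed
  ultimately show ?thesis using d unfolding forms_angle_def by auto
qed

lemma is_angle_if_not_collinear: "\<not> collinear A B C \<Longrightarrow> is_angle (angle A B C)"
  using forms_angle_if_not_collinear unfolding is_angle_def by blast

lemma ang_cong_sym: "\<lbrakk>is_angle \<alpha>; is_angle \<beta>; ang_cong \<alpha> \<beta>\<rbrakk> \<Longrightarrow> ang_cong \<beta> \<alpha>"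
  using C5_euclidean C5_refl by blast

lemma seg_cong_sym: "\<lbrakk>is_segment s; is_segment t; seg_cong s t\<rbrakk> \<Longrightarrow> seg_cong t s"
  using C2_euclidean C2_refl by blast

section \<open>Interiors of angles and the crossbar theorem\<close>

lemma betw_interior:
  assumes "\<not> collinear A B C" "betw A P C"
  shows "P \<in> angle_interior A B C"
proof -
  note d = not_collinear_distinct[OF assms(1)]
  have "\<not> inc C (line_through B A)" "\<not> inc A (line_through B C)"
    using not_inc_line_through assms(1) collinear_rotate collinear_swap by blast+
  then have "same_side (line_through B A) P C" "same_side (line_through B C) P A"
    using betw_same_side assms(2) betw_commute inc_line_through d by metis+
  then show ?thesis unfolding angle_interior_def by simp
qed

text \<open>
  The point \<open>A'\<close> beyond \<open>B\<close> on the line \<open>AB\<close> lies across the line \<open>BH\<close> from \<open>A\<close>, but the segment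
  \<open>A'C\<close> cannot meet that line; hence \<open>A\<close> and \<open>C\<close> are separated by it.
\<close>
lemma crossbar:
  assumes nc: "\<not> collinear A B C" and H: "H \<in> angle_interior A B C"
  obtains P where "betw A P C" "ray B P = ray B H"
proof -
  define a where "a = line_through B A"
  define c where "c = line_through B C"
  define l where "l = line_through B H"
  note d = not_collinear_distinct[OF nc]
  have a: "inc B a" "inc A a" and c: "inc B c" "inc C c"
    using inc_line_through d a_def c_def by metis+
  have Ha: "same_side a H C" and Hc: "same_side c H A"
    using H unfolding angle_interior_def a_def c_def by auto
  have "B \<noteq> H" using Ha a same_sideD by blast
  then have l: "inc B l" "inc H l" using inc_line_through l_def by metis+
  have Al: "\<not> inc A l" using line_unique[of A B a l] d a l Ha same_sideD by blast
  have Cl: "\<not> inc C l" using line_unique[of C B c l] d c l Hc same_sideD by blast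
  have on_ray: "X \<in> ray B H" if "inc X l" "same_side a X C" for X
    using same_side_imp_ray[OF a(1)] O4_same[OF that(2) same_side_sym[OF Ha]] that(1) l
    unfolding collinear_def by blast
  obtain A' where A': "betw A B A'" using O2[of A B] d by blast
  have A'a: "inc A' a" using betw_inc_right[OF A'] a by blast
  have A'l: "\<not> inc A' l" using betw_inc_left[OF A'] l Al by blast
  have A'c: "\<not> inc A' c" using betw_inc_left[OF A'] c Hc same_sideD by blast
  \<comment> \<open>Such an \<open>X\<close> would lie on the ray \<open>BH\<close>, hence on the
    same side of \<open>c\<close> as \<open>A\<close>. Being between \<open>A'\<close> and
    \<open>C\<close>, it also lies on the side of \<open>A'\<close>, yet \<open>c\<close> separates
    \<open>A\<close> from \<open>A'\<close> at \<open>B\<close>.\<close>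
  have "\<not> inc X l" if X: "betw A' X C" for X
  proof
    assume "inc X l"
    have Xa: "same_side a X C" using betw_same_side[OF X A'a] Ha same_sideD by blast
    then have "X \<in> ray B H" using on_ray \<open>inc X l\<close> by blast
    moreover have "X \<noteq> B" using Xa a same_sideD by blast
    ultimately have "same_side c X H" using ray_imp_same_side c Hc same_sideD by blast
    then have "same_side c A X" using O4_same Hc same_side_sym by blast
    moreover have "same_side c X A'" using betw_same_side[of C X A' c] X betw_commute c A'c by blast
    ultimately have "same_side c A A'" by (rule O4_same)
    then show False using betw_not_same_side[OF A'] c by blast
  qed
  then have "same_side l C A'"
    using not_same_side_betw[of l A' C] A'l Cl same_side_sym by metis
  then have "\<not> same_side l A C" using O4_same betw_not_same_side[OF A'] l by blast
  then obtain P where P: "betw A P C" "inc P l" using not_same_side_betw Al Cl by blast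
  have Pa: "same_side a P C" using betw_same_side P(1) a Ha same_sideD by blast
  then have "P \<noteq> B" using a same_sideD by blast
  then have "ray B P = ray B H" using ray_eq[OF \<open>B \<noteq> H\<close>] on_ray P(2) Pa by blast
  with P(1) show thesis by (rule that)
qed

section \<open>Comparison of triangles by ASA and ray correspondence\<close>

lemma angle_ray_cong: "ray B C = ray B C' \<Longrightarrow> angle A B C = angle A B C'"
  unfolding angle_def by simp

lemma ray_betw: "betw A P C \<Longrightarrow> ray A P = ray A C"
  using ray_eq[of A C P] betw_distinct[of A P C] unfolding ray_def by auto

text \<open>Excludes that the angle at \<open>B\<close> is smaller than the angle at
  \<open>E\<close>. Both triangles are arbitrary, so exchanging them excludes the reverse
  inequality.\<close>

lemma SAS_angle_not_less:
  assumes ASA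
    and nc: "\<not> collinear A B C" "\<not> collinear D E F"
    and sides: "seg_cong (segment A B) (segment D E)" "seg_cong (segment A C) (segment D F)"
    and A: "ang_cong (angle B A C) (angle E D F)"
    and H: "H \<in> angle_interior D E F" "ang_cong (angle A B C) (angle D E H)"
  shows False
proof -
  obtain P where P: "betw D P F" "ray E P = ray E H" using crossbar[OF nc(2) H(1)] by blast
  note d = betw_distinct[OF P(1)]
  have rP: "ray D P = ray D F" using ray_betw P(1) by blast
  have "triangle_cong A B C D E P"
    using \<open>ASA\<close>[unfolded ASA_def] nc(1) not_collinear_betw[OF nc(2) P(1)] sides(1) A H(2)
      angle_ray_cong[OF P(2)] angle_ray_cong[OF rP]
    unfolding triangle_def by metis
  then have "seg_cong (segment A C) (segment D P)" unfolding triangle_cong_def by blast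
  moreover have "P \<in> ray D F" "F \<in> ray D F" using P(1) unfolding ray_def by auto
  \<comment> \<open>\<open>P\<close> and \<open>F\<close> are distinct points of one ray from
    \<open>D\<close>, both at distance \<open>AC\<close>.\<close>
  ultimately show False
    using C1[of A C D F] not_collinear_distinct[OF nc(1)] d sides(2) by blast
qed

theorem ASA_RCT_imp_SAS:
  assumes ASA RCT
  shows SAS
  unfolding SAS_def
proof (intro allI impI)
  fix A B C D E F
  assume tri: "triangle A B C" "triangle D E F"
    and AB: "seg_cong (segment A B) (segment D E)"
    and A: "ang_cong (angle B A C) (angle E D F)"
    and AC: "seg_cong (segment A C) (segment D F)"
  have nc: "\<not> collinear A B C" "\<not> collinear D E F" using tri unfolding triangle_def by auto
  note dA = not_collinear_distinct[OF nc(1)] and dD = not_collinear_distinct[OF nc(2)]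
  define e where "e = line_through E D"
  have e: "inc E e" "inc D e" using inc_line_through dD e_def by metis+
  have Fe: "\<not> inc F e" using not_inc_line_through nc(2) collinear_swap e_def by blast
  obtain K where K: "same_side e K F" "ang_cong (angle D E K) (angle A B C)"
    using C4[OF forms_angle_if_not_collinear[OF nc(1)], of E D F] dD Fe e_def by metis
  have Ke: "\<not> inc K e" using K same_sideD by blast
  then have ncK: "\<not> collinear D E K" using not_collinearI e dD by metis
  have K': "ang_cong (angle A B C) (angle D E K)"
    using ang_cong_sym is_angle_if_not_collinear ncK nc(1) K(2) by blast
  define f where "f = line_through E F"
  have f: "inc E f" "inc F f" using inc_line_through dD f_def by metis+
  have Df: "\<not> inc D f" using f nc(2) unfolding collinear_def by blast
  \<comment> \<open>The position of \<open>K\<close> relative to the line \<open>EF\<close> decides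
    whether the copied angle is equal to, smaller than or larger than the angle
    \<open>DEF\<close>.\<close>
  consider "inc K f" | "same_side f K D" | P where "betw D P K" "inc P f"
    using not_same_side_betw[of f D K] Df same_side_sym by blast
  then show "triangle_cong A B C D E F"
  proof cases
    case 1
    then have "K \<in> ray E F" using same_side_imp_ray e(1) K(1) f unfolding collinear_def by blast
    moreover have "K \<noteq> E" using Ke e by blast
    ultimately have "angle D E K = angle D E F" using ray_eq dD angle_ray_cong by metis
    then show ?thesis using \<open>ASA\<close>[unfolded ASA_def] tri A AB K' by metis
  next
    case 2
    then have "K \<in> angle_interior D E F"
      using K(1) unfolding angle_interior_def e_def f_def by simp
    then show ?thesis using SAS_angle_not_less[OF \<open>ASA\<close> nc AB AC A] K' by blast
  next
    case 3
    \<comment> \<open>\<open>P\<close> lies on the line \<open>EF\<close> on the same side of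
      \<open>e\<close> as \<open>F\<close>, so it names the ray \<open>EF\<close>, which therefore
      lies inside the angle \<open>DEK\<close>.\<close>
    have PK: "same_side e P K" using betw_same_side 3(1) e Ke by blast
    then have "P \<in> ray E F"
      using same_side_imp_ray[OF e(1) O4_same[OF PK K(1)]] f 3(2) unfolding collinear_def by blast
    moreover have "P \<noteq> E" using PK e same_sideD by blast
    ultimately have angP: "angle D E P = angle D E F" using ray_eq dD angle_ray_cong by metis
    have "P \<in> angle_interior D E K" using betw_interior ncK 3(1) by blast
    then obtain H where H: "H \<in> angle_interior A B C" "ang_cong (angle D E P) (angle A B H)"
      using \<open>RCT\<close>[unfolded RCT_def] forms_angle_if_not_collinear[OF ncK]
        forms_angle_if_not_collinear[OF nc(1)] K(2) by meson
    have "\<not> collinear B A C" "\<not> collinear E D F" using nc collinear_swap by blast+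
    then have "ang_cong (angle E D F) (angle B A C)"
      using ang_cong_sym is_angle_if_not_collinear A by blast
    moreover have "seg_cong (segment D E) (segment A B)" "seg_cong (segment D F) (segment A C)"
      using seg_cong_sym AB AC dA dD unfolding is_segment_def by blast+
    \<comment> \<open>The triangles are exchanged: the angle \<open>DEF\<close> is congruent to the
      part \<open>ABH\<close> of the angle \<open>ABC\<close>, which is contradictory.\<close>
    ultimately show ?thesis
      using SAS_angle_not_less[OF \<open>ASA\<close> nc(2,1)] H angP by metis
  qed
qed

end

theorem theorem2p4:
  fixes inc :: "'p \<Rightarrow> 'l \<Rightarrow> bool"
    and betw :: "'p \<Rightarrow> 'p \<Rightarrow> 'p \<Rightarrow> bool"
    and seg_cong :: "'p set \<Rightarrow> 'p set \<Rightarrow> bool"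
    and ang_cong :: "'p set set \<Rightarrow> 'p set set \<Rightarrow> bool"
  assumes "hilbert_plane_without_SAS inc betw seg_cong ang_cong"
    and "plane_signature.ASA inc betw seg_cong ang_cong"
    and "plane_signature.RCT inc betw ang_cong"
  shows "plane_signature.SAS inc betw seg_cong ang_cong"
  using hilbert_plane_without_SAS.ASA_RCT_imp_SAS[OF assms] .

end
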